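(* Let $q$ be a power of a prime $p$, let $F$ be a field containing $\mathbb{F}_q$, and let $f(z)=\sum_{i\ge 0} f_i z^{q^i}\in F[[z]]$ be a nonzero power series. Write $h(z)=zf'(z)/f(z)=\sum_{i\ge 0} h_i z^i$. Then for every integer $\ell$ with $1\le \ell\le q$, every integer $k\ge 0$, and all integers $k_1,\dots,k_\ell$ with $0\le k_j\le k$ for $1\le j\le \ell$, we have $$\prod_{j=1}^{\ell} h_{q^k-q^{k_j}} = h_{\sum_{j=1}^{\ell}(q^k-q^{k_j})}.$$
   Context: Here $f'$ is the formal derivative, so $f'(z)=f_0$ and $h(z)=f_0z/f(z)$; if $f_0\neq 0$ this is a power series in $z$ with $h_0=1$, and if $f_0=0$ then $h$ is identically $0$ (all $h_i=0$). *)

theory Defs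
  imports
    "HOL-Computational_Algebra.Formal_Power_Series"
    "HOL-Algebra.Algebraic_Closure_Type"
begin

end

(* If f_0 = 0 then f' = 0 and h = 0. Otherwise put M = l q^k; the right-hand side is the
   coefficient of z^M in h times the product of the z^(q^(k_j)). Each factor z^(q^(k_j)) is,
   up to high order, a linear combination of powers f^(q^i). Multiplying out and using
   h f = f_0 z, one is left with the coefficients of z^(M - 1) in f^(S - 1), where S is a sum of
   l powers of q. As l <= q, such a coefficient vanishes unless all these powers equal q^k, by
   induction on k: modulo q, the exponents of f are 0 or (for the linear term only) 1, so the
   coefficient at an exponent congruent to -1 is 0 unless q divides S, and otherwise it is
   obtained by a Frobenius power from S/q and M/q. Hence h at the sum of the q^k - q^(k_j) is a
   product of one factor for each j, and the case l = 1 identifies these factors. *)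

theory Submission
  imports Defs
begin

section \<open>Divisibility by powers of X and congruences of products\<close>

lemma fps_X_power_dvd_iff:
  fixes r :: "'a :: field fps"
  shows "fps_X ^ m dvd r \<longleftrightarrow> (\<forall>n<m. fps_nth r n = 0)"
proof
  assume "fps_X ^ m dvd r"
  then show "\<forall>n<m. fps_nth r n = 0"
    by (auto simp: fps_X_power_mult_nth)
next
  assume "\<forall>n<m. fps_nth r n = 0"
  then have "r = fps_X ^ m * fps_shift m r"
    by (intro fps_ext) (auto simp: fps_X_power_mult_nth)
  then show "fps_X ^ m dvd r"
    by (rule dvdI)
qed

text \<open>Congruences modulo \<open>d\<close> may be multiplied; with \<open>d\<close> a power of
  \<open>fps_X\<close> this justifies replacing every factor by a truncation.\<close>

lemma prod_diff_dvd:
  fixes u v :: "'b \<Rightarrow> 'c :: comm_ring_1"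
  assumes "\<And>j. j \<in> J \<Longrightarrow> d dvd u j - v j"
  shows "d dvd prod u J - prod v J"
  using assms
proof (induction J rule: infinite_finite_induct)
  case (insert j J)
  have "prod u (insert j J) - prod v (insert j J)
      = u j * (prod u J - prod v J) + (u j - v j) * prod v J"
    using insert.hyps by (simp add: algebra_simps)
  then show ?case
    using insert by simp
qed auto

lemma fps_const_prod:
  fixes u :: "'b \<Rightarrow> 'a :: comm_ring_1"
  shows "fps_const (prod u J) = (\<Prod>j\<in>J. fps_const (u j))"
  by (induction J rule: infinite_finite_induct) (simp_all flip: fps_const_mult)

section \<open>Characteristic and Frobenius powers\<close>

text \<open>Translation by 1 permutes the finite set \<open>K\<close>, so comparing the sums of all
  elements before and after gives \<open>of_nat (card K) = 0\<close>.\<close>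

lemma CHAR_eq_if_card_subfield:
  fixes K :: "'a :: field set"
  assumes "subfield K (ring_of_type_algebra :: 'a ring)" and "card K = p ^ e"
    and "Factorial_Ring.prime (p :: nat)"
  shows "CHAR('a) = p"
proof -
  have sub: "subring K (ring_of_type_algebra :: 'a ring)"
    using assms(1) by (rule subfieldE)
  have one: "1 \<in> K" and add: "\<And>x y. x \<in> K \<Longrightarrow> y \<in> K \<Longrightarrow> x + y \<in> K"
    using subringE(3,7)[OF sub] by (simp_all add: ring_of_type_algebra_def)
  have "card K > 0"
    using assms(2,3) by (simp add: prime_gt_0_nat)
  then have fin: "finite K"
    by (rule card_ge_0_finite)
  have inj: "inj_on (\<lambda>x. x + 1) K"
    by (simp add: inj_on_def)
  have "(\<lambda>x. x + 1) ` K = K"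
    using fin inj one add by (intro endo_inj_surj) auto
  then have "(\<Sum>x\<in>K. x) = (\<Sum>x\<in>K. x + 1)"
    using sum.reindex[OF inj, of "\<lambda>x. x"] by (simp add: o_def)
  then have "of_nat (card K) = (0 :: 'a)"
    by (simp add: sum.distrib)
  then have "of_nat p = (0 :: 'a)"
    using assms(2) by simp
  then have "CHAR('a) dvd p"
    by (simp add: of_nat_eq_0_iff_char_dvd)
  moreover have "CHAR('a) \<noteq> 1"
    using CHAR_not_1 by (metis One_nat_def)
  ultimately show ?thesis
    using assms(3) unfolding prime_nat_iff by blast
qed

text \<open>The freshman's dream concerns finite sums, so it is applied to a truncation
  \<open>t\<close> of \<open>f\<close>, whose power has the same coefficient at
  \<open>n\<close>.\<close>

lemma fps_nth_power_CHAR_power: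
  fixes f :: "'a :: field fps"
  assumes prime: "Factorial_Ring.prime CHAR('a)" and q: "q = CHAR('a) ^ e"
  shows "fps_nth (f ^ q) n = (if q dvd n then fps_nth f (n div q) ^ q else 0)"
proof -
  have "q > 0"
    using prime q by (simp add: prime_gt_0_nat)
  define t where "t = (\<Sum>i\<le>n. fps_const (fps_nth f i) * fps_X ^ i)"
  have t_nth: "fps_nth t m = (if m \<le> n then fps_nth f m else 0)" for m
    unfolding t_def by (simp add: fps_sum_nth fps_X_power_nth if_distrib cong: if_cong)
  have "fps_X ^ Suc n dvd f - t"
    by (subst fps_X_power_dvd_iff) (simp add: t_nth)
  \<comment> \<open>The powers are written as constant products to fit
    \<open>prod_diff_dvd\<close>.\<close>
  then have "fps_X ^ Suc n dvd (\<Prod>i<q. f) - (\<Prod>i<q. t)"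
    by (intro prod_diff_dvd)
  then have "fps_nth (f ^ q) n = fps_nth (t ^ q) n"
    unfolding fps_X_power_dvd_iff by simp
  also have "t ^ q = (\<Sum>i\<le>n. (fps_const (fps_nth f i) * fps_X ^ i) ^ q)"
    unfolding t_def by (rule freshmans_dream_sum') (simp_all add: prime q)
  also have "fps_nth \<dots> n = (\<Sum>i\<le>n. if n = i * q then fps_nth f i ^ q else 0)"
    by (auto simp: fps_sum_nth power_mult_distrib fps_const_power fps_X_power_nth
        simp flip: power_mult intro!: sum.cong)
  also have "\<dots> = (if q dvd n then fps_nth f (n div q) ^ q else 0)"
  proof (cases "q dvd n")
    case True
    then obtain m where m: "n = m * q"
      by (metis dvd_def mult.commute)
    then have "m \<le> n"
      using \<open>q > 0\<close> by simp
    have "(\<Sum>i\<le>n. if n = i * q then fps_nth f i ^ q else 0)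
        = (\<Sum>i\<le>n. if m = i then fps_nth f i ^ q else 0)"
      using \<open>q > 0\<close> by (intro sum.cong) (auto simp: m)
    then show ?thesis
      using \<open>m \<le> n\<close> \<open>q > 0\<close> m by simp
  next
    case False
    then show ?thesis
      by (auto intro!: sum.neutral)
  qed
  finally show ?thesis .
qed

section \<open>Series supported on powers of q\<close>

text \<open>A condition on the support encodes the series \<Sum> c_i X^(q^i) without carrying a
  coefficient sequence or its convergence along.\<close>

definition supported_on_powers :: "nat \<Rightarrow> 'a :: zero fps \<Rightarrow> bool"
  where "supported_on_powers q g \<longleftrightarrow> (\<forall>n. fps_nth g n \<noteq> 0 \<longrightarrow> (\<exists>i. n = q ^ i))"

lemma supported_on_powers_X_power: "supported_on_powers q (fps_X ^ (q ^ i) :: 'a :: field fps)"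
  by (auto simp: supported_on_powers_def fps_X_power_nth split: if_splits)

lemma supported_on_powers_diff_const_mult:
  fixes g g' :: "'a :: field fps"
  assumes "supported_on_powers q g" and "supported_on_powers q g'"
  shows "supported_on_powers q (g - fps_const c * g')"
  using assms unfolding supported_on_powers_def
  by (metis diff_zero fps_mult_left_const_nth fps_sub_nth mult_zero_right)

lemma supported_on_powers_sums:
  fixes c :: "nat \<Rightarrow> 'a :: field"
  assumes "(\<lambda>i. fps_const (c i) * fps_X ^ (q ^ i)) sums f"
  shows "supported_on_powers q f"
  unfolding supported_on_powers_def
proof (intro allI impI, rule ccontr)
  fix n
  assume nz: "fps_nth f n \<noteq> 0" and "\<nexists>i. n = q ^ i"
  then have 0: "fps_nth (\<Sum>i<N. fps_const (c i) * fps_X ^ (q ^ i)) n = 0" for N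
    by (auto simp: fps_sum_nth fps_X_power_nth intro!: sum.neutral)
  \<comment> \<open>Convergence makes each coefficient of the partial sums eventually
    constant.\<close>
  have "\<forall>\<^sub>F N in sequentially.
      fps_nth (\<Sum>i<N. fps_const (c i) * fps_X ^ (q ^ i)) n = fps_nth f n"
    using assms unfolding sums_def tendsto_fps_iff by blast
  then have "\<forall>\<^sub>F N in sequentially. False"
    by (rule eventually_mono) (use 0 nz in simp)
  then show False
    by simp
qed

locale q_additive_fps =
  fixes f :: "'a :: field fps" and q e :: nat
  assumes prime_CHAR: "Factorial_Ring.prime CHAR('a)"
    and e_pos: "e > 0" and q_eq: "q = CHAR('a) ^ e"
    and supported: "supported_on_powers q f"
begin

lemma q_gt_1: "q > 1"
  unfolding q_eq using prime_CHAR e_pos by (meson one_less_power prime_gt_1_nat)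

lemma nth_power_q: "fps_nth (g ^ q) n = (if q dvd n then fps_nth g (n div q) ^ q else 0)"
  for g :: "'a fps"
  using prime_CHAR q_eq by (rule fps_nth_power_CHAR_power)

lemma nth_0: "fps_nth f 0 = 0"
  using supported q_gt_1 unfolding supported_on_powers_def by force

lemma nth_eq_0: "fps_nth f n = 0" if "n \<noteq> 1" and "\<not> q dvd n"
proof (rule ccontr)
  assume "fps_nth f n \<noteq> 0"
  then obtain i where "n = q ^ i"
    using supported unfolding supported_on_powers_def by blast
  then show False
    using that by (cases i) auto
qed

lemma of_nat_q: "of_nat q = (0 :: 'a)"
  unfolding q_eq using e_pos by simp

text \<open>Beyond the linear term all exponents are multiples of \<open>q\<close>, which is 0 in
  the field.\<close>

lemma deriv: "fps_deriv f = fps_const (fps_nth f 1)"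
proof (rule fps_ext)
  fix n
  have "of_nat (Suc n) * fps_nth f (Suc n) = 0" if "n > 0"
  proof (cases "q dvd Suc n")
    case True
    then have "of_nat (Suc n) = (0 :: 'a)"
      using of_nat_q by (metis dvd_def mult_zero_left of_nat_mult)
    then show ?thesis
      by (simp only: mult_zero_left)
  qed (use nth_eq_0 that in auto)
  then show "fps_nth (fps_deriv f) n = fps_nth (fps_const (fps_nth f 1)) n"
    by (cases "n = 0") (simp_all del: of_nat_Suc add: fps_deriv_nth of_nat_1[unfolded One_nat_def])
qed

lemma supported_power: "supported_on_powers q (f ^ (q ^ i))"
proof (induction i)
  case 0
  then show ?case
    using supported by simp
next
  case (Suc i)
  have "f ^ (q ^ Suc i) = (f ^ (q ^ i)) ^ q"
    by (simp add: mult.commute flip: power_mult)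
  moreover have "supported_on_powers q ((f ^ (q ^ i)) ^ q)"
    unfolding supported_on_powers_def
  proof (intro allI impI)
    fix n
    assume "fps_nth ((f ^ (q ^ i)) ^ q) n \<noteq> 0"
    then have "q dvd n" and "fps_nth (f ^ (q ^ i)) (n div q) \<noteq> 0"
      using q_gt_1 by (auto simp: nth_power_q zero_power split: if_splits)
    then obtain m where "n div q = q ^ m"
      using Suc unfolding supported_on_powers_def by blast
    then have "n = q ^ Suc m"
      using \<open>q dvd n\<close> by (metis dvd_mult_div_cancel power_Suc)
    then show "\<exists>i. n = q ^ i" ..
  qed
  ultimately show ?case
    by simp
qed

section \<open>Coefficients of powers of f\<close>

text \<open>Each of the \<open>b\<close> factors contributes 0 or 1 modulo \<open>q\<close>. As
  \<open>b < q\<close>, a residue of at least \<open>b\<close> is reached only if all of them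
  contribute their linear term.\<close>

lemma nth_power_ge_residue:
  assumes "b < q" and "b \<le> n mod q"
  shows "fps_nth (f ^ b) n = (if n = b then fps_nth f 1 ^ b else 0)"
  using assms
proof (induction b arbitrary: n)
  case (Suc b)
  then have n: "n \<noteq> 0"
    by (intro notI) simp
  have pred: "(n - 1) mod q = n mod q - 1"
    using Suc.prems by (cases n) (auto simp: mod_Suc split: if_splits)
  \<comment> \<open>An exponent \<open>i\<close> divisible by \<open>q\<close> leaves the residue at
    \<open>Suc b\<close> or more, which the remaining \<open>b\<close> factors cannot reach.\<close>
  have zero: "fps_nth f i * fps_nth (f ^ b) (n - i) = 0" if "i \<noteq> 1" "i \<le> n" for i
  proof (cases "q dvd i")
    case True
    then have "(n - i) mod q = n mod q"
      using \<open>i \<le> n\<close> by (metis dvd_def le_add_diff_inverse2 mod_mult_self2)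
    moreover from this have "n - i \<noteq> b"
      using Suc.prems by auto
    ultimately show ?thesis
      using Suc.IH[of "n - i"] Suc.prems by simp
  qed (use nth_eq_0 that in simp)
  have "fps_nth (f ^ Suc b) n = (\<Sum>i=0..n. fps_nth f i * fps_nth (f ^ b) (n - i))"
    by (simp add: fps_mult_nth)
  also have "\<dots> = (\<Sum>i\<in>{1}. fps_nth f i * fps_nth (f ^ b) (n - i))"
    using n zero by (intro sum.mono_neutral_right) auto
  also have "\<dots> = (if n = Suc b then fps_nth f 1 ^ Suc b else 0)"
    using Suc.IH[of "n - 1"] Suc.prems n pred by auto
  finally show ?case .
qed auto

text \<open>The factor \<open>(f ^ a) ^ q\<close> has only exponents divisible by \<open>q\<close>,
  so \<open>f ^ b\<close> must supply the residue -1. This needs \<open>b = q - 1\<close> and the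
  exponent exactly \<open>q - 1\<close>, which leaves \<open>q * (M - 1)\<close> for the Frobenius
  power.\<close>

lemma nth_power_residue_minus_1:
  assumes "b < q" and "M > 0"
  shows "fps_nth (f ^ (q * a + b)) (q * M - 1)
       = (if b = q - 1 then fps_nth f 1 ^ (q - 1) * fps_nth (f ^ a) (M - 1) ^ q else 0)"
proof -
  have rem: "(q * M - 1 - q * i) mod q = q - 1" and less: "q * i \<le> q * M - 1" if i_less: "i < M" for i
  proof -
    obtain d where d: "M = Suc (i + d)"
      using less_imp_Suc_add[OF i_less] by blast
    have "q * M - 1 - q * i = (q - 1) + q * d"
      unfolding d using q_gt_1 by (simp add: algebra_simps)
    then show "(q * M - 1 - q * i) mod q = q - 1"
      using q_gt_1 by (metis diff_less mod_less mod_mult_self2 not_gr_zero not_less_zero zero_less_one)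
    show "q * i \<le> q * M - 1"
      unfolding d using q_gt_1 by (simp add: algebra_simps)
  qed
  have "f ^ (q * a + b) = (f ^ a) ^ q * f ^ b"
    by (simp add: power_add mult.commute flip: power_mult)
  then have "fps_nth (f ^ (q * a + b)) (q * M - 1)
      = (\<Sum>j = 0..q * M - 1. fps_nth ((f ^ a) ^ q) j * fps_nth (f ^ b) (q * M - 1 - j))"
    by (simp add: fps_mult_nth)
  also have "\<dots> = (\<Sum>j\<in>{q * (M - 1)}. if b = q - 1
      then fps_nth f 1 ^ (q - 1) * fps_nth (f ^ a) (M - 1) ^ q else 0)"
  proof (rule sum.mono_neutral_cong_right)
    show "{q * (M - 1)} \<subseteq> {0..q * M - 1}"
      using less[of "M - 1"] assms by simp
    have M: "q * M - 1 - q * (M - 1) = q - 1"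
      using assms q_gt_1 by (cases M) auto
    have "fps_nth (f ^ b) (q - 1) = (if b = q - 1 then fps_nth f 1 ^ (q - 1) else 0)"
      using nth_power_ge_residue[of b "q - 1"] assms by auto
    then show "fps_nth ((f ^ a) ^ q) j * fps_nth (f ^ b) (q * M - 1 - j)
        = (if b = q - 1 then fps_nth f 1 ^ (q - 1) * fps_nth (f ^ a) (M - 1) ^ q else 0)"
      if "j \<in> {q * (M - 1)}" for j
      using that M q_gt_1 by (simp add: nth_power_q)
    show "\<forall>j\<in>{0..q * M - 1} - {q * (M - 1)}.
        fps_nth ((f ^ a) ^ q) j * fps_nth (f ^ b) (q * M - 1 - j) = 0"
    proof
      fix j
      assume j: "j \<in> {0..q * M - 1} - {q * (M - 1)}"
      show "fps_nth ((f ^ a) ^ q) j * fps_nth (f ^ b) (q * M - 1 - j) = 0"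
      proof (cases "q dvd j")
        case True
        then obtain i where i: "j = q * i" ..
        have "q * i \<le> q * M - 1" and "q * M > 0"
          using j q_gt_1 assms by (simp_all add: i)
        then have "q * i < q * M"
          by linarith
        then have "i < M"
          by simp
        moreover have "q * M - 1 - j \<noteq> b"
        proof
          assume "q * M - 1 - j = b"
          then have "q * M \<le> q * i + q"
            using assms(1) i by linarith
          then have "q * M \<le> q * Suc i"
            by simp
          then have "M \<le> Suc i"
            using q_gt_1 by (metis less_trans mult_le_cancel1 zero_less_one)
          with \<open>i < M\<close> have "i = M - 1"
            by simp
          with j i show False
            by simp
        qed
        ultimately show ?thesis
          using nth_power_ge_residue[of b "q * M - 1 - j"] rem[of i] assms by (simp add: i)
      qed (simp add: nth_power_q)
    qed
  qed simp
  finally show ?thesis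
    by simp
qed

text \<open>Each induction step strips one factor \<open>q\<close> from the sum and from
  \<open>card J * q ^ k\<close>. By \<open>card J \<le> q\<close>, a sum divisible by
  \<open>q\<close> has either all its summands divisible by \<open>q\<close> or all of them equal to
  1; the second case gives 0.\<close>

lemma nth_power_sum_powers:
  assumes "finite J" and "J \<noteq> {}" and "card J \<le> q"
  shows "fps_nth (f ^ ((\<Sum>j\<in>J. q ^ \<sigma> j) - 1)) (card J * q ^ k - 1)
       = (if \<forall>j\<in>J. \<sigma> j = k then fps_nth f 1 ^ (card J * q ^ k - 1) else 0)"
proof (induction k arbitrary: \<sigma>)
  case 0
  show ?case
  proof (cases "\<forall>j\<in>J. \<sigma> j = 0")
    case True
    then show ?thesis
      using startsby_zero_power_nth_same[OF nth_0] by simp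
  next
    case False
    then obtain j where j: "j \<in> J" "\<sigma> j \<noteq> 0"
      by blast
    \<comment> \<open>One summand above 1 pushes the sum above \<open>card J\<close>, so the power
      of \<open>f\<close> starts beyond the exponent \<open>card J - 1\<close>.\<close>
    have "1 < q ^ \<sigma> j"
      using j q_gt_1 by (intro one_less_power) auto
    then have "(\<Sum>j\<in>J. 1) < (\<Sum>j\<in>J. q ^ \<sigma> j)"
      using assms j q_gt_1
      by (intro sum_strict_mono_ex1) (auto simp: Suc_le_eq)
    then have "card J - 1 < (\<Sum>j\<in>J. q ^ \<sigma> j) - 1"
      using assms by (simp add: card_gt_0_iff diff_less_mono Suc_le_eq)
    then have "fps_nth (f ^ ((\<Sum>j\<in>J. q ^ \<sigma> j) - 1)) (card J * q ^ 0 - 1) = 0"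
      using startsby_zero_power_prefix[OF nth_0] by simp
    then show ?thesis
      using False by (simp only: if_False)
  qed
next
  case (Suc k)
  define S where "S = (\<Sum>j\<in>J. q ^ \<sigma> j)"
  define M where "M = card J * q ^ k"
  have card: "card J > 0"
    using assms by (simp add: card_gt_0_iff)
  have M: "M > 0" "card J * q ^ Suc k = q * M"
    using card q_gt_1 by (simp_all add: M_def)
  have S: "S > 0"
    unfolding S_def using assms q_gt_1 by (intro sum_pos) auto
  have split: "S - 1 = q * ((S - 1) div q) + (S - 1) mod q"
    by simp
  have mod_less: "(S - 1) mod q < q"
    using q_gt_1 by simp
  show ?case
  proof (cases "q dvd S")
    case False
    have "(S - 1) mod q \<noteq> q - 1"
    proof
      assume "(S - 1) mod q = q - 1"
      then have "S = q * ((S - 1) div q) + q"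
        using split S q_gt_1 by linarith
      then have "q dvd S"
        by (metis dvd_add dvd_refl dvd_triv_left)
      with False show False ..
    qed
    then have "fps_nth (f ^ (S - 1)) (q * M - 1) = 0"
      using nth_power_residue_minus_1[OF mod_less M(1), of "(S - 1) div q"] by simp
    moreover have "\<not> (\<forall>j\<in>J. \<sigma> j = Suc k)"
    proof
      assume "\<forall>j\<in>J. \<sigma> j = Suc k"
      then have "q dvd S"
        unfolding S_def by (intro dvd_sum) simp
      with False show False ..
    qed
    ultimately show ?thesis
      using M by (simp only: S_def if_False)
  next
    case True
    then obtain T where T: "S = q * T" ..
    with S have "T > 0"
      by (cases T) auto
    have "S - 1 = q * (T - 1) + (q - 1)"
      using T \<open>T > 0\<close> q_gt_1 by (cases T) auto
    then have step: "fps_nth (f ^ (S - 1)) (q * M - 1)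
        = fps_nth f 1 ^ (q - 1) * fps_nth (f ^ (T - 1)) (M - 1) ^ q"
      using nth_power_residue_minus_1[of "q - 1" M "T - 1"] M q_gt_1 by simp
    show ?thesis
    proof (cases "\<exists>j\<in>J. \<sigma> j = 0")
      case False
      have pow: "q ^ \<sigma> j = q * q ^ (\<sigma> j - 1)" if "j \<in> J" for j
        using False that by (metis power_eq_if)
      have "S = q * (\<Sum>j\<in>J. q ^ (\<sigma> j - 1))"
        unfolding S_def sum_distrib_left by (rule sum.cong) (simp_all add: pow)
      then have T': "T = (\<Sum>j\<in>J. q ^ (\<sigma> j - 1))"
        using T q_gt_1 by simp
      have iff: "(\<forall>j\<in>J. \<sigma> j - 1 = k) \<longleftrightarrow> (\<forall>j\<in>J. \<sigma> j = Suc k)"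
        using False by (metis One_nat_def Suc_pred diff_Suc_1 not_gr_zero)
      \<comment> \<open>Joins the \<open>q - 1\<close> linear terms with the \<open>q\<close>-th
        power of the value from the induction hypothesis.\<close>
      have exp: "q - 1 + (M - 1) * q = q * M - 1"
        using M q_gt_1 by (cases M) (auto simp: algebra_simps)
      have "fps_nth (f ^ (T - 1)) (M - 1)
          = (if \<forall>j\<in>J. \<sigma> j = Suc k then fps_nth f 1 ^ (M - 1) else 0)"
        using Suc[of "\<lambda>j. \<sigma> j - 1"] unfolding T' M_def iff .
      then have "fps_nth (f ^ (S - 1)) (q * M - 1)
          = (if \<forall>j\<in>J. \<sigma> j = Suc k then fps_nth f 1 ^ (q * M - 1) else 0)"
        using q_gt_1 exp unfolding step by (simp add: zero_power flip: power_mult power_add)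
      then show ?thesis
        using M by (simp only: S_def)
    next
      case True
      \<comment> \<open>The summands outside \<open>Z\<close> are divisible by \<open>q\<close>,
        hence so is \<open>card Z\<close>. Being positive and at most \<open>card J \<le> q\<close>,
        it equals \<open>q\<close>, so every summand is 1.\<close>
      define Z where "Z = {j \<in> J. \<sigma> j = 0}"
      have Z: "finite Z" "Z \<subseteq> J" "Z \<noteq> {}"
        using True assms by (auto simp: Z_def)
      have "S = (\<Sum>j\<in>J - Z. q ^ \<sigma> j) + (\<Sum>j\<in>Z. q ^ \<sigma> j)"
        unfolding S_def using assms(1) Z(2) by (rule sum.subset_diff[rotated])
      also have "(\<Sum>j\<in>Z. q ^ \<sigma> j) = card Z"
        by (simp add: Z_def)
      finally have S_split: "S = (\<Sum>j\<in>J - Z. q ^ \<sigma> j) + card Z" .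
      have "q dvd (\<Sum>j\<in>J - Z. q ^ \<sigma> j)"
        by (rule dvd_sum) (auto simp: Z_def)
      then have "q dvd card Z"
        using \<open>q dvd S\<close> S_split by (simp add: dvd_add_right_iff)
      then have "q \<le> card Z"
        using Z by (intro dvd_imp_le) (auto simp: card_gt_0_iff)
      moreover have "card Z \<le> card J"
        using Z assms by (intro card_mono)
      ultimately have "card Z = card J" and card_J: "card J = q"
        using assms(3) by linarith+
      then have "Z = J"
        using Z assms(1) by (intro card_subset_eq)
      then have "S = q * 1"
        using S_split card_J by simp
      then have "T = 1"
        using T q_gt_1 by simp
      \<comment> \<open>Thus \<open>f ^ (T - 1)\<close> is 1, with coefficient 0 at
        \<open>M - 1 > 0\<close>.\<close>
      moreover have "M > 1"
        using card_J one_less_power[OF q_gt_1, of "Suc k"] by (simp add: M_def)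
      ultimately have "fps_nth (f ^ (S - 1)) (q * M - 1) = 0"
        using q_gt_1 unfolding step by (simp add: zero_power)
      moreover have "\<not> (\<forall>j\<in>J. \<sigma> j = Suc k)"
        using True by force
      ultimately show ?thesis
        using M by (simp only: S_def if_False)
    qed
  qed
qed

section \<open>Expansion in the powers f^(q^i)\<close>

text \<open>When \<open>g\<close> is \<open>fps_X\<close>, the \<open>c i\<close> are the coefficients of the compositional inverse of \<open>f\<close>,
  truncated so that no infinite sum has to be multiplied out later.\<close>

lemma ex_expansion:
  assumes "fps_nth f 1 \<noteq> 0" and "supported_on_powers q g"
  shows "\<exists>c. fps_X ^ (q ^ N) dvd g - (\<Sum>i<N. fps_const (c i) * f ^ (q ^ i))"
proof -
  \<comment> \<open>The support is carried through the induction: once the coefficient at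
    \<open>q ^ N\<close> is cancelled, the next possible exponent is
    \<open>q ^ Suc N\<close>.\<close>
  have "\<exists>c. supported_on_powers q (g - (\<Sum>i<N. fps_const (c i) * f ^ (q ^ i)))
      \<and> fps_X ^ (q ^ N) dvd g - (\<Sum>i<N. fps_const (c i) * f ^ (q ^ i))"
  proof (induction N)
    case 0
    have "fps_nth g 0 = 0"
      using assms(2) q_gt_1 unfolding supported_on_powers_def by force
    then show ?case
      using assms(2) fps_X_power_dvd_iff[of 1 g] by simp
  next
    case (Suc N)
    then obtain c where c: "supported_on_powers q (g - (\<Sum>i<N. fps_const (c i) * f ^ (q ^ i)))"
      "fps_X ^ (q ^ N) dvd g - (\<Sum>i<N. fps_const (c i) * f ^ (q ^ i))"
      by blast
    define r where "r = g - (\<Sum>i<N. fps_const (c i) * f ^ (q ^ i))"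
    \<comment> \<open>Cancels the coefficient at \<open>q ^ N\<close>, since
      \<open>f ^ (q ^ N)\<close> starts there with \<open>fps_nth f 1 ^ (q ^ N)\<close>.\<close>
    define a where "a = fps_nth r (q ^ N) / fps_nth f 1 ^ (q ^ N)"
    define r' where "r' = r - fps_const a * f ^ (q ^ N)"
    have supp: "supported_on_powers q r'"
      unfolding r'_def using c(1) supported_power
      by (intro supported_on_powers_diff_const_mult) (simp_all add: r_def)
    have zero: "fps_nth r' n = 0" if "n < q ^ Suc N" for n
    proof (rule ccontr)
      assume nz: "fps_nth r' n \<noteq> 0"
      then obtain i where i: "n = q ^ i"
        using supp unfolding supported_on_powers_def by blast
      then have "i \<le> N"
        using that q_gt_1 by (metis less_Suc_eq_le power_strict_increasing_iff)
      show False
      proof (cases "i = N")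
        case True
        then have "fps_nth r' n = 0"
          using assms(1) startsby_zero_power_nth_same[OF nth_0, of "q ^ N"]
          by (simp add: r'_def i a_def)
        with nz show False ..
      next
        case False
        then have "n < q ^ N"
          using \<open>i \<le> N\<close> q_gt_1 i by simp
        then have "fps_nth r' n = 0"
          using c(2) startsby_zero_power_prefix[OF nth_0, of "q ^ N"]
          unfolding fps_X_power_dvd_iff r'_def by (simp add: r_def)
        with nz show False ..
      qed
    qed
    have "r' = g - (\<Sum>i<Suc N. fps_const ((c(N := a)) i) * f ^ (q ^ i))"
      by (simp add: r'_def r_def algebra_simps)
    moreover have "fps_X ^ (q ^ Suc N) dvd r'"
      using zero unfolding fps_X_power_dvd_iff by blast
    ultimately show ?case
      using supp by (intro exI[of _ "c(N := a)"]) simp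
  qed
  then show ?thesis
    by blast
qed

section \<open>Coefficients of h\<close>

text \<open>After the product of the expansions is multiplied out, \<open>h\<close> is absorbed by
  one factor \<open>f\<close>, and \<open>nth_power_sum_powers\<close> leaves only the term that
  takes index \<open>k\<close> in every factor.\<close>

lemma nth_X_div_sum:
  assumes f1: "fps_nth f 1 \<noteq> 0"
    and h: "h * f = fps_const (fps_nth f 1) * fps_X"
    and expansion: "\<And>m. fps_X ^ (q ^ (k + 2)) dvd
      fps_X ^ (q ^ m) - (\<Sum>i<k+2. fps_const (\<mu> m i) * f ^ (q ^ i))"
    and J: "finite J" "J \<noteq> {}" "card J \<le> q"
    and le: "\<And>j. j \<in> J \<Longrightarrow> \<kappa> j \<le> k"
  shows "fps_nth h (\<Sum>j\<in>J. q ^ k - q ^ \<kappa> j) = (\<Prod>j\<in>J. fps_nth f 1 ^ (q ^ k) * \<mu> (\<kappa> j) k)"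
proof -
  define M where "M = card J * q ^ k"
  define S where "S \<sigma> = (\<Sum>j\<in>J. q ^ \<sigma> j)" for \<sigma> :: "'b \<Rightarrow> nat"
  \<comment> \<open>A choice \<open>\<sigma>\<close> in \<open>P\<close> takes the term of index
    \<open>\<sigma> j\<close> from factor \<open>j\<close>; the chosen terms multiply to
    \<open>w \<sigma>\<close> times \<open>f ^ S \<sigma>\<close>.\<close>
  define P where "P = PiE J (\<lambda>_. {..<k+2})"
  define w where "w \<sigma> = (\<Prod>j\<in>J. \<mu> (\<kappa> j) (\<sigma> j))" for \<sigma>
  \<comment> \<open>Members of \<open>PiE\<close> are \<open>undefined\<close> outside
    \<open>J\<close>, hence the restriction.\<close>
  define \<sigma>\<^sub>0 where "\<sigma>\<^sub>0 = restrict (\<lambda>_. k) J"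
  have S_pos: "S \<sigma> > 0" for \<sigma>
    unfolding S_def using J q_gt_1 by (intro sum_pos) auto
  have M_pos: "M > 0"
    unfolding M_def using J q_gt_1 by (simp add: card_gt_0_iff)
  \<comment> \<open>If \<open>card J = q\<close>, then \<open>M\<close> equals
    \<open>q ^ (k + 1)\<close>; truncation at \<open>q ^ (k + 2)\<close> keeps the coefficient at
    \<open>M\<close> intact in this case too.\<close>
  have "M \<le> q * q ^ k"
    unfolding M_def using J(3) by simp
  also have "\<dots> < q ^ (k + 2)"
    using q_gt_1 by simp
  finally have M_less: "M < q ^ (k + 2)" .
  have powers_le: "q ^ \<kappa> j \<le> q ^ k" if "j \<in> J" for j
    using le[OF that] q_gt_1 by (intro power_increasing) auto
  have "(\<Sum>j\<in>J. q ^ k - q ^ \<kappa> j) = M - S \<kappa>"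
    unfolding M_def S_def using powers_le by (subst sum_subtractf_nat) auto
  moreover have S_le: "S \<kappa> \<le> M"
    unfolding M_def S_def using sum_bounded_above[of J "\<lambda>j. q ^ \<kappa> j" "q ^ k"] powers_le by simp
  ultimately have lhs: "fps_nth h (\<Sum>j\<in>J. q ^ k - q ^ \<kappa> j) = fps_nth (fps_X ^ S \<kappa> * h) M"
    by (simp add: fps_X_power_mult_nth)
  define E where "E = (\<Prod>j\<in>J. \<Sum>i<k+2. fps_const (\<mu> (\<kappa> j) i) * f ^ (q ^ i))"
  have "fps_X ^ (q ^ (k + 2)) dvd (\<Prod>j\<in>J. fps_X ^ (q ^ \<kappa> j)) - E"
    unfolding E_def by (intro prod_diff_dvd expansion)
  then have "fps_X ^ (q ^ (k + 2)) dvd (fps_X ^ S \<kappa> - E) * h"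
    by (simp add: S_def power_sum)
  then have "fps_nth ((fps_X ^ S \<kappa> - E) * h) M = 0"
    using M_less unfolding fps_X_power_dvd_iff by blast
  then have "fps_nth (fps_X ^ S \<kappa> * h) M = fps_nth (E * h) M"
    by (simp add: left_diff_distrib)
  also have "E = (\<Sum>\<sigma>\<in>P. fps_const (w \<sigma>) * f ^ S \<sigma>)"
    unfolding E_def P_def using J(1)
    by (subst prod_sum_PiE) (auto simp: prod.distrib w_def S_def power_sum fps_const_prod)
  also have "fps_nth (\<dots> * h) M = (\<Sum>\<sigma>\<in>P. w \<sigma> * fps_nth (f ^ S \<sigma> * h) M)"
    by (simp add: sum_distrib_right fps_sum_nth mult.assoc)
  also have "\<dots> = (\<Sum>\<sigma>\<in>P. if \<sigma> = \<sigma>\<^sub>0 then w \<sigma> * fps_nth f 1 ^ M else 0)"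
  proof (rule sum.cong)
    fix \<sigma>
    assume "\<sigma> \<in> P"
    then have iff: "(\<forall>j\<in>J. \<sigma> j = k) \<longleftrightarrow> \<sigma> = \<sigma>\<^sub>0"
      unfolding P_def \<sigma>\<^sub>0_def by (auto simp: PiE_iff extensional_def restrict_def fun_eq_iff)
    have "f ^ S \<sigma> * h = f ^ (S \<sigma> - 1) * (h * f)"
      using S_pos[of \<sigma>] by (cases "S \<sigma>") (simp_all add: mult_ac)
    also have "\<dots> = fps_const (fps_nth f 1) * (fps_X * f ^ (S \<sigma> - 1))"
      unfolding h by (simp add: mult_ac)
    also have "fps_nth \<dots> M = fps_nth f 1 * fps_nth (f ^ (S \<sigma> - 1)) (M - 1)"
      using M_pos by simp
    also have "\<dots> = (if \<sigma> = \<sigma>\<^sub>0 then fps_nth f 1 ^ M else 0)"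
    proof -
      have "fps_nth (f ^ (S \<sigma> - 1)) (M - 1) = (if \<sigma> = \<sigma>\<^sub>0 then fps_nth f 1 ^ (M - 1) else 0)"
        using nth_power_sum_powers[OF J, of \<sigma> k] unfolding iff S_def M_def .
      then show ?thesis
        using power_minus_mult[OF M_pos, of "fps_nth f 1"] by (simp add: mult.commute)
    qed
    finally show "w \<sigma> * fps_nth (f ^ S \<sigma> * h) M = (if \<sigma> = \<sigma>\<^sub>0 then w \<sigma> * fps_nth f 1 ^ M else 0)"
      by simp
  qed simp
  also have "\<dots> = w \<sigma>\<^sub>0 * fps_nth f 1 ^ M"
  proof -
    have "finite P" "\<sigma>\<^sub>0 \<in> P"
      using J(1) by (auto simp: P_def \<sigma>\<^sub>0_def intro: finite_PiE)
    then show ?thesis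
      by simp
  qed
  also have "\<dots> = (\<Prod>j\<in>J. fps_nth f 1 ^ (q ^ k) * \<mu> (\<kappa> j) k)"
    by (simp add: w_def \<sigma>\<^sub>0_def prod.distrib M_def mult.commute flip: power_mult)
  finally show ?thesis
    unfolding lhs .
qed

text \<open>The same \<open>\<mu>\<close> serves for \<open>J\<close> and for each singleton
  \<open>{j}\<close>, so the singletons identify the factors of the product.\<close>

lemma prod_nth_X_div:
  assumes f1: "fps_nth f 1 \<noteq> 0"
    and h: "h * f = fps_const (fps_nth f 1) * fps_X"
    and J: "finite J" "J \<noteq> {}" "card J \<le> q"
    and le: "\<And>j. j \<in> J \<Longrightarrow> \<kappa> j \<le> k"
  shows "(\<Prod>j\<in>J. fps_nth h (q ^ k - q ^ \<kappa> j)) = fps_nth h (\<Sum>j\<in>J. q ^ k - q ^ \<kappa> j)"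
proof -
  obtain \<mu> where \<mu>: "\<And>m. fps_X ^ (q ^ (k + 2)) dvd
      fps_X ^ (q ^ m) - (\<Sum>i<k+2. fps_const (\<mu> m i) * f ^ (q ^ i))"
    using ex_expansion[OF f1 supported_on_powers_X_power, of "k + 2"] by metis
  have "fps_nth h (q ^ k - q ^ \<kappa> j) = fps_nth f 1 ^ (q ^ k) * \<mu> (\<kappa> j) k" if "j \<in> J" for j
    using nth_X_div_sum[OF f1 h \<mu>, of "{j}" \<kappa>] le[OF that] q_gt_1 by simp
  then show ?thesis
    using nth_X_div_sum[OF f1 h \<mu> J le] by simp
qed

end

theorem theorem1:
  fixes p e q :: nat
    and K :: "'a :: field set"
    and f h :: "'a fps" and c :: "nat \<Rightarrow> 'a"
    and l k :: nat and \<kappa> :: "nat \<Rightarrow> nat"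
  assumes "Factorial_Ring.prime p" and "e > 0" and "q = p ^ e"
    and "subfield K (ring_of_type_algebra :: 'a ring)" and "card K = q"
    and "(\<lambda>i. fps_const (c i) * fps_X ^ (q ^ i)) sums f" and "f \<noteq> 0"
    and "h = fps_X * fps_deriv f / f"
    and "1 \<le> l" and "l \<le> q"
    and "\<And>j. j \<in> {1..l} \<Longrightarrow> \<kappa> j \<le> k"
  shows "(\<Prod>j = 1..l. fps_nth h (q ^ k - q ^ \<kappa> j))
       = fps_nth h (\<Sum>j = 1..l. q ^ k - q ^ \<kappa> j)"
proof -
  \<comment> \<open>The finite subfield fixes the characteristic, which makes \<open>q\<close>-th
    powers additive.\<close>
  have "CHAR('a) = p"
    using assms by (intro CHAR_eq_if_card_subfield) auto
  then interpret q_additive_fps f q e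
    using assms supported_on_powers_sums by unfold_locales auto
  show ?thesis
  \<comment> \<open>As \<open>q ^ 0 = 1\<close>, the coefficient f_0 of the statement is
    \<open>fps_nth f 1\<close>. If it is 0, both sides vanish, the product being nonempty.\<close>
  proof (cases "fps_nth f 1 = 0")
    case True
    then have "h = 0"
      using assms(8) deriv by simp
    then show ?thesis
      using \<open>1 \<le> l\<close> by simp
  next
    case False
    \<comment> \<open>Since \<open>f\<close> starts at exponent 1, it divides the numerator, so the
      quotient defining \<open>h\<close> is exact.\<close>
    then have "subdegree f = 1"
      using nth_0 by (intro subdegreeI) auto
    then have "f dvd fps_const (fps_nth f 1) * fps_X"
      using False \<open>f \<noteq> 0\<close> by (simp add: fps_dvd_iff)
    then have "h * f = fps_const (fps_nth f 1) * fps_X"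
      using assms(8) deriv by (simp add: mult.commute)
    then show ?thesis
      using prod_nth_X_div[OF False, of h "{1..l}" \<kappa> k] assms(9-11) by simp
  qed
qed

end
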